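(* Let $X$ be a chain and let $\alpha,\beta\in\mathcal{OP}(X)$. Then $\alpha\,\mathcal{J}\,\beta$ in $\mathcal{OP}(X)$ if and only if there exist injective mappings $\theta:\mathrm{Im}(\alpha)\to\mathrm{Im}(\beta)$ and $\tau:\mathrm{Im}(\beta)\to\mathrm{Im}(\alpha)$ admitting completable inverses in $\mathcal{OP}(X)$.
   Context: $X$ is a chain (totally ordered set), finite or infinite. Maps are written on the right and composed from left to right: $x(\alpha\beta)=(x\alpha)\beta$. A full transformation $\alpha:X\to X$ is orientation-preserving if it is the empty transformation (only when $X=\emptyset$) or there exists a non-empty subset $Y$ of $X$ such that: (OP1) $\alpha$ is order-preserving (i.e. $x\le y$ implies $x\alpha\le y\alpha$) both on $Y$ and on $X\setminus Y$; (OP2) for all $a\in Y$ and $b\in X\setminus Y$, $a\le b$ and $a\alpha\ge b\alpha$. $\mathcal{OP}(X)$ is the monoid, under composition, of all orientation-preserving full transformations of $X$. Green's relation $\mathcal{J}$ on a monoid $S$: $\alpha\,\mathcal{J}\,\beta$ iff $S\alpha S=S\beta S$. For $A,B\subseteq X$, a mapping $\theta:A\to B$ is completable in $\mathcal{OP}(X)$ if there exists $\gamma\in\mathcal{OP}(X)$ with $x\gamma=x\theta$ for all $x\in A$. An injective mapping $\theta:A\to B$ admits a completable inverse in $\mathcal{OP}(X)$ if the inverse mapping $\theta^{-1}:\mathrm{Im}(\theta)\to A$ of the bijection $\theta:A\to\mathrm{Im}(\theta)$ is completable in $\mathcal{OP}(X)$. *)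

theory Defs
  imports "HOL-Algebra.Group" "HOL-Library.FuncSet"
begin

text \<open>
  A chain is a subset \<open>X\<close> of a linearly ordered type, with the induced order; in this way the
  empty chain is covered as well.  A full transformation of \<open>X\<close> is an element of
  \<open>X \<rightarrow>\<^sub>E X\<close>: such functions are \<open>undefined\<close> outside \<open>X\<close>, so that
  equality of functions is equality of transformations of \<open>X\<close>.
\<close>

definition orientation_preserving :: "'a::linorder set \<Rightarrow> ('a \<Rightarrow> 'a) \<Rightarrow> bool" where
  "orientation_preserving X \<alpha> \<longleftrightarrow>
     X = {} \<or>
     (\<exists>Y. Y \<noteq> {} \<and> Y \<subseteq> X \<and>
          mono_on Y \<alpha> \<and> mono_on (X - Y) \<alpha> \<and>
          (\<forall>a\<in>Y. \<forall>b\<in>X - Y. a \<le> b \<and> \<alpha> a \<ge> \<alpha> b))"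

definition OP :: "'a::linorder set \<Rightarrow> ('a \<Rightarrow> 'a) set" where
  "OP X = {\<alpha> \<in> X \<rightarrow>\<^sub>E X. orientation_preserving X \<alpha>}"

text \<open>
  Maps act on the right and are composed from left to right, so the product of \<open>\<alpha>\<close> and
  \<open>\<beta>\<close> applies \<open>\<alpha>\<close> first.
\<close>

definition OP_monoid :: "'a::linorder set \<Rightarrow> ('a \<Rightarrow> 'a) monoid" where
  "OP_monoid X =
     \<lparr>carrier = OP X, mult = (\<lambda>\<alpha> \<beta>. compose X \<beta> \<alpha>), one = (\<lambda>x\<in>X. x)\<rparr>"

definition principal_two_sided_ideal :: "('b, 'c) monoid_scheme \<Rightarrow> 'b \<Rightarrow> 'b set" where
  "principal_two_sided_ideal S a =
     {x \<otimes>\<^bsub>S\<^esub> a \<otimes>\<^bsub>S\<^esub> y | x y. x \<in> carrier S \<and> y \<in> carrier S}"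

definition green_J :: "('b, 'c) monoid_scheme \<Rightarrow> ('b \<times> 'b) set" where
  "green_J S =
     {(a, b). a \<in> carrier S \<and> b \<in> carrier S \<and>
              principal_two_sided_ideal S a = principal_two_sided_ideal S b}"

text \<open>
  In the next two definitions \<open>\<theta>\<close> stands for a mapping with domain \<open>A \<subseteq> X\<close>;
  its values outside \<open>A\<close> are irrelevant.
\<close>

definition completable :: "'a::linorder set \<Rightarrow> 'a set \<Rightarrow> ('a \<Rightarrow> 'a) \<Rightarrow> bool" where
  "completable X A \<theta> \<longleftrightarrow> (\<exists>\<gamma>\<in>OP X. \<forall>x\<in>A. \<gamma> x = \<theta> x)"

text \<open>
  Meant for \<open>\<theta>\<close> injective on \<open>A\<close>: then \<open>inv_into A \<theta>\<close> is, on
  \<open>\<theta> ` A\<close>, the inverse of the bijection from \<open>A\<close> onto \<open>\<theta> ` A\<close>.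
\<close>

definition admits_completable_inverse :: "'a::linorder set \<Rightarrow> 'a set \<Rightarrow> ('a \<Rightarrow> 'a) \<Rightarrow> bool" where
  "admits_completable_inverse X A \<theta> \<longleftrightarrow> completable X (\<theta> ` A) (inv_into A \<theta>)"

end

theory Submission
  imports Defs
begin

text \<open>
  In any monoid, \<open>a \<J> b\<close> says that each of \<open>a\<close>, \<open>b\<close> is a
  two-sided multiple of the other (\<open>green_J_iff_mem_ideals\<close>), so it is enough to understand when
  \<open>\<alpha>\<close> is a multiple of \<open>\<beta>\<close>; lemma \<open>mem_ideal_OP_iff\<close> shows that
  this happens exactly when some injection \<open>Im \<alpha> \<rightarrow> Im \<beta>\<close> admits a completable
  inverse.

  If \<open>\<alpha> = \<gamma>\<beta>\<delta>\<close> (left factor applied first), every point of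
  \<open>Im \<alpha>\<close> is hit by \<open>\<delta>\<close> from some point of \<open>Im \<beta>\<close>, and a choice of
  such points is an injection whose inverse is a restriction of \<open>\<delta>\<close>.  Conversely, let
  \<open>\<gamma>\<close> in \<open>OP(X)\<close> complete the inverse of an injection \<open>\<theta>\<close>, and let
  \<open>\<sigma>\<close> be a section of \<open>\<beta>\<close>.  Then \<open>\<alpha> = (\<alpha>\<theta>\<sigma>)\<beta>\<gamma>\<close>, and the
  only question is whether \<open>\<alpha>\<theta>\<sigma>\<close> preserves orientation.  It does, because \<open>\<theta>\<close> and
  \<open>\<sigma>\<close> are inverses of injective restrictions of \<open>\<gamma>\<close> and \<open>\<beta>\<close>, and the
  class of orientation-preserving maps between subsets of a chain is closed under restriction,
  inversion and composition.
\<close>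

section \<open>Orientation-preserving maps on subsets of a chain\<close>

lemma orientation_preservingI:
  assumes "Y \<subseteq> A" and "A \<noteq> {} \<Longrightarrow> Y \<noteq> {}" and "mono_on Y f" and "mono_on (A - Y) f"
    and "\<And>a b. a \<in> Y \<Longrightarrow> b \<in> A - Y \<Longrightarrow> a \<le> b \<and> f b \<le> f a"
  shows "orientation_preserving A f"
  using assms unfolding orientation_preserving_def by blast

text \<open>
  If the candidate for the lower part is empty, the map is order-preserving, and then the whole
  domain serves as the lower part.  Stated this way, the criterion spares the closure properties
  below the case distinctions on which pieces happen to be empty.
\<close>

lemma orientation_preservingI_possibly_empty:
  assumes "Y \<subseteq> A" and "mono_on Y f" and "mono_on (A - Y) f"
    and "\<And>a b. a \<in> Y \<Longrightarrow> b \<in> A - Y \<Longrightarrow> a \<le> b \<and> f b \<le> f a"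
  shows "orientation_preserving A f"
proof (cases "Y = {}")
  case True
  with assms(3) show ?thesis by (intro orientation_preservingI[of A]) auto
next
  case False
  with assms show ?thesis by (intro orientation_preservingI[of Y]) auto
qed

lemma orientation_preservingE:
  assumes "orientation_preserving A f"
  obtains Y where "Y \<subseteq> A" "mono_on Y f" "mono_on (A - Y) f"
    "\<And>a b. a \<in> Y \<Longrightarrow> b \<in> A - Y \<Longrightarrow> a \<le> b \<and> f b \<le> f a"
proof (cases "A = {}")
  case True
  then show ?thesis by (intro that[of "{}"]) auto
next
  case False
  then show ?thesis using assms that unfolding orientation_preserving_def by blast
qed

lemma orientation_preserving_subset:
  assumes "orientation_preserving A f" and "B \<subseteq> A"
  shows "orientation_preserving B f"
proof -
  obtain Y where "Y \<subseteq> A" "mono_on Y f" "mono_on (A - Y) f"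
    "\<And>a b. a \<in> Y \<Longrightarrow> b \<in> A - Y \<Longrightarrow> a \<le> b \<and> f b \<le> f a"
    using assms(1) by (rule orientation_preservingE) blast
  with assms(2) show ?thesis
    by (intro orientation_preservingI_possibly_empty[of "Y \<inter> B"])
      (auto intro: mono_on_subset)
qed

lemma orientation_preserving_cong:
  assumes "orientation_preserving A f" and "\<And>x. x \<in> A \<Longrightarrow> f x = g x"
  shows "orientation_preserving A g"
proof -
  obtain Y where "Y \<subseteq> A" "mono_on Y f" "mono_on (A - Y) f"
    "\<And>a b. a \<in> Y \<Longrightarrow> b \<in> A - Y \<Longrightarrow> a \<le> b \<and> f b \<le> f a"
    using assms(1) by (rule orientation_preservingE) blast
  with assms(2) show ?thesis
    by (intro orientation_preservingI_possibly_empty[of Y])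
      (auto simp: monotone_on_def subset_iff)
qed

lemma mono_on_left_inverse:
  fixes f :: "'a::linorder \<Rightarrow> 'b::linorder"
  assumes "mono_on A f" and "\<And>x. x \<in> A \<Longrightarrow> g (f x) = x"
  shows "mono_on (f ` A) g"
proof (rule mono_onI)
  fix u v assume "u \<in> f ` A" "v \<in> f ` A" "u \<le> v"
  then obtain x y where xy: "x \<in> A" "y \<in> A" "u = f x" "v = f y" by blast
  show "g u \<le> g v"
  proof (rule ccontr)
    assume "\<not> g u \<le> g v"
    with xy assms(2) have "y < x" by simp
    with xy assms(1) have "v \<le> u" by (simp add: mono_onD)
    with \<open>u \<le> v\<close> have "f x = f y" by (simp add: xy)
    with xy assms(2) have "x = y" by metis
    with \<open>y < x\<close> show False by simp
  qed
qed

text \<open>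
  The map sends the upper part of its domain below the image of the lower part, so for the inverse
  the two parts trade places: the image of the upper part is the new lower part.
\<close>

lemma orientation_preserving_left_inverse:
  assumes "orientation_preserving A f" and inv: "\<And>x. x \<in> A \<Longrightarrow> g (f x) = x"
  shows "orientation_preserving (f ` A) g"
proof -
  obtain Y where Y: "Y \<subseteq> A" "mono_on Y f" "mono_on (A - Y) f"
    "\<And>a b. a \<in> Y \<Longrightarrow> b \<in> A - Y \<Longrightarrow> a \<le> b \<and> f b \<le> f a"
    using assms(1) by (rule orientation_preservingE) blast
  have "inj_on f A"
    using inv by (rule inj_on_inverseI)
  with Y(1) have compl: "f ` A - f ` (A - Y) = f ` Y"
    by (auto simp: inj_on_def)
  show ?thesis
  proof (rule orientation_preservingI_possibly_empty[of "f ` (A - Y)"])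
    show "mono_on (f ` (A - Y)) g"
      using Y(3) inv by (intro mono_on_left_inverse) auto
    show "mono_on (f ` A - f ` (A - Y)) g"
      unfolding compl using Y(1,2) inv by (intro mono_on_left_inverse) auto
  next
    fix a b assume "a \<in> f ` (A - Y)" "b \<in> f ` A - f ` (A - Y)"
    then show "a \<le> b \<and> g b \<le> g a"
      unfolding compl using Y(1,4) inv by (auto simp: subset_iff)
  qed auto
qed

text \<open>
  The inner map sends the upper part \<open>A - Y\<close> below the image of \<open>Y\<close>, and the lower
  part \<open>Z\<close> of the outer map is an initial piece of \<open>B\<close>.  Hence \<open>Z\<close> either
  absorbs the whole image of \<open>A - Y\<close>, or misses the image of \<open>Y\<close> altogether: the cut of
  the outer map splits at most one of \<open>Y\<close> and \<open>A - Y\<close>.  In the first case the elements of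
  \<open>Y\<close> mapped into \<open>Z\<close> form the lower part of the composite, because the rest of
  \<open>Y\<close> is sent below the image of \<open>A - Y\<close>; in the second case the elements of
  \<open>A - Y\<close> mapped into \<open>Z\<close> are sent by the composite above
  the image of \<open>Y\<close> and form its lower part together with \<open>Y\<close>.
\<close>

lemma orientation_preserving_comp:
  assumes "orientation_preserving A f" and "orientation_preserving B g" and fAB: "f ` A \<subseteq> B"
  shows "orientation_preserving A (g \<circ> f)"
proof -
  obtain Y where Y: "Y \<subseteq> A" "mono_on Y f" "mono_on (A - Y) f"
    "\<And>a b. a \<in> Y \<Longrightarrow> b \<in> A - Y \<Longrightarrow> a \<le> b \<and> f b \<le> f a"
    using assms(1) by (rule orientation_preservingE) blast
  obtain Z where Z: "Z \<subseteq> B" "mono_on Z g" "mono_on (B - Z) g"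
    "\<And>a b. a \<in> Z \<Longrightarrow> b \<in> B - Z \<Longrightarrow> a \<le> b \<and> g b \<le> g a"
    using assms(2) by (rule orientation_preservingE) blast
  have YA: "x \<in> A" if "x \<in> Y" for x using Y(1) that by blast
  have fB: "f x \<in> B" if "x \<in> A" for x using fAB that by blast
  have gZ: "g u \<le> g v" if "u \<le> v" "u \<in> B" "v \<in> B" "u \<in> Z \<longleftrightarrow> v \<in> Z" for u v
    using that Z(2,3) by (auto simp: monotone_on_def)
  have fY: "f x \<le> f y" if "x \<le> y" "x \<in> A" "y \<in> A" "x \<in> Y \<longleftrightarrow> y \<in> Y" for x y
    using that Y(2,3) by (auto simp: monotone_on_def)
  have Zlow: "u < v" "g v \<le> g u" if "u \<in> Z" "v \<in> B" "v \<notin> Z" for u v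
    using Z(4)[of u v] that by (auto simp: order_less_le)
  have Ylow: "x < y" "f y \<le> f x" if "x \<in> Y" "y \<in> A" "y \<notin> Y" for x y
    using Y(4)[of x y] that by (auto simp: order_less_le)
  have pull: "x < y" if "f x \<in> Z" "f y \<notin> Z" "x \<in> A" "y \<in> A" "x \<in> Y \<longleftrightarrow> y \<in> Y" for x y
    using fY[of y x] Zlow(1)[of "f x" "f y"] that fB by (metis leD not_le)
  show ?thesis
  proof (cases "f ` (A - Y) \<subseteq> Z")
    case True
    show ?thesis
    proof (rule orientation_preservingI_possibly_empty[of "{x \<in> Y. f x \<in> Z}"])
      show "mono_on {x \<in> Y. f x \<in> Z} (g \<circ> f)"
        by (auto intro!: mono_onI gZ fY fB YA)
      show "mono_on (A - {x \<in> Y. f x \<in> Z}) (g \<circ> f)"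
      proof (rule mono_onI)
        fix x y assume xy: "x \<in> A - {x \<in> Y. f x \<in> Z}" "y \<in> A - {x \<in> Y. f x \<in> Z}" "x \<le> y"
        consider "x \<in> Y \<longleftrightarrow> y \<in> Y" | "x \<in> Y" "y \<notin> Y" | "x \<notin> Y" "y \<in> Y" by blast
        then show "(g \<circ> f) x \<le> (g \<circ> f) y"
        proof cases
          case 1
          with xy True fB show ?thesis by (auto intro!: gZ fY)
        next
          case 2
          with xy True fB show ?thesis by (auto intro!: Zlow(2))
        next
          case 3
          with xy Ylow(1)[of y x] show ?thesis by auto
        qed
      qed
    next
      fix a b assume ab: "a \<in> {x \<in> Y. f x \<in> Z}" "b \<in> A - {x \<in> Y. f x \<in> Z}"
      show "a \<le> b \<and> (g \<circ> f) b \<le> (g \<circ> f) a"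
      proof (cases "b \<in> Y")
        case True
        with ab Y(1) fB pull[of a b] Zlow(2)[of "f a" "f b"] show ?thesis by auto
      next
        case False
        with ab Y(1) fB True Ylow[of a b] show ?thesis by (auto intro!: gZ)
      qed
    qed (use Y(1) in auto)
  next
    case False
    then obtain p where p: "p \<in> A" "p \<notin> Y" "f p \<notin> Z" by blast
    have YZ: "f y \<notin> Z" if "y \<in> Y" for y
      using Ylow(2)[of y p] Zlow(1)[of "f y" "f p"] p that fB by fastforce
    show ?thesis
    proof (rule orientation_preservingI_possibly_empty[of "Y \<union> {x \<in> A. f x \<in> Z}"])
      show "mono_on (A - (Y \<union> {x \<in> A. f x \<in> Z})) (g \<circ> f)"
        using fB by (auto intro!: mono_onI gZ fY)
      show "mono_on (Y \<union> {x \<in> A. f x \<in> Z}) (g \<circ> f)"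
      proof (rule mono_onI)
        fix x y assume xy: "x \<in> Y \<union> {x \<in> A. f x \<in> Z}" "y \<in> Y \<union> {x \<in> A. f x \<in> Z}" "x \<le> y"
        then have A: "x \<in> A" "y \<in> A" using Y(1) by auto
        consider "x \<in> Y \<longleftrightarrow> y \<in> Y" | "x \<in> Y" "y \<notin> Y" | "x \<notin> Y" "y \<in> Y" by blast
        then show "(g \<circ> f) x \<le> (g \<circ> f) y"
        proof cases
          case 1
          with xy A YZ fB show ?thesis by (auto intro!: gZ fY)
        next
          case 2
          with xy A YZ fB show ?thesis by (auto intro!: Zlow(2))
        next
          case 3
          with xy A Ylow(1)[of y x] show ?thesis by auto
        qed
      qed
    next
      fix a b assume ab: "a \<in> Y \<union> {x \<in> A. f x \<in> Z}" "b \<in> A - (Y \<union> {x \<in> A. f x \<in> Z})"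
      show "a \<le> b \<and> (g \<circ> f) b \<le> (g \<circ> f) a"
      proof (cases "a \<in> Y")
        case True
        with ab Y(1) fB YZ Ylow[of a b] show ?thesis by (auto intro!: gZ)
      next
        case False
        with ab fB pull[of a b] Zlow(2)[of "f a" "f b"] show ?thesis by auto
      qed
    qed (use Y(1) in auto)
  qed
qed

section \<open>Principal ideals and the monoid of orientation-preserving transformations\<close>

lemma orientation_preserving_id: "orientation_preserving X (\<lambda>x\<in>X. x)"
  by (rule orientation_preservingI[of X]) (auto intro: mono_onI)

lemma compose_in_OP:
  assumes "\<alpha> \<in> OP X" and "\<beta> \<in> OP X"
  shows "compose X \<beta> \<alpha> \<in> OP X"
proof -
  have "orientation_preserving X (\<beta> \<circ> \<alpha>)"
    using assms by (intro orientation_preserving_comp[of X \<alpha> X]) (auto simp: OP_def)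
  then have "orientation_preserving X (compose X \<beta> \<alpha>)"
    by (rule orientation_preserving_cong) (simp add: compose_def)
  with assms show ?thesis
    by (auto simp: OP_def compose_def PiE_iff)
qed

lemma monoid_OP: "monoid (OP_monoid X)"
proof (rule monoidI)
  fix x y z
  assume "x \<in> carrier (OP_monoid X)" "y \<in> carrier (OP_monoid X)" "z \<in> carrier (OP_monoid X)"
  then show "x \<otimes>\<^bsub>OP_monoid X\<^esub> y \<otimes>\<^bsub>OP_monoid X\<^esub> z
      = x \<otimes>\<^bsub>OP_monoid X\<^esub> (y \<otimes>\<^bsub>OP_monoid X\<^esub> z)"
    by (auto simp: OP_monoid_def OP_def compose_def PiE_iff fun_eq_iff)
next
  fix x assume "x \<in> carrier (OP_monoid X)"
  then show "\<one>\<^bsub>OP_monoid X\<^esub> \<otimes>\<^bsub>OP_monoid X\<^esub> x = x"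
    and "x \<otimes>\<^bsub>OP_monoid X\<^esub> \<one>\<^bsub>OP_monoid X\<^esub> = x"
    by (auto simp: OP_monoid_def OP_def compose_def PiE_iff fun_eq_iff extensional_def)
qed (auto simp: OP_monoid_def compose_in_OP, auto simp: OP_def orientation_preserving_id)

context monoid
begin

lemma principal_two_sided_ideal_mono:
  assumes "a \<in> principal_two_sided_ideal G b" and b: "b \<in> carrier G"
  shows "principal_two_sided_ideal G a \<subseteq> principal_two_sided_ideal G b"
proof
  obtain x y where xy: "x \<in> carrier G" "y \<in> carrier G" "a = x \<otimes> b \<otimes> y"
    using assms(1) by (auto simp: principal_two_sided_ideal_def)
  fix c assume "c \<in> principal_two_sided_ideal G a"
  then obtain u v where uv: "u \<in> carrier G" "v \<in> carrier G" "c = u \<otimes> a \<otimes> v"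
    by (auto simp: principal_two_sided_ideal_def)
  have "c = (u \<otimes> x) \<otimes> b \<otimes> (y \<otimes> v)"
    using xy uv b by (simp add: m_assoc)
  with xy uv show "c \<in> principal_two_sided_ideal G b"
    unfolding principal_two_sided_ideal_def by blast
qed

lemma mem_principal_two_sided_ideal_self:
  assumes "a \<in> carrier G"
  shows "a \<in> principal_two_sided_ideal G a"
proof -
  have "a = \<one> \<otimes> a \<otimes> \<one>" using assms by simp
  then show ?thesis unfolding principal_two_sided_ideal_def by blast
qed

lemma green_J_iff_mem_ideals:
  assumes "a \<in> carrier G" and "b \<in> carrier G"
  shows "(a, b) \<in> green_J G \<longleftrightarrow>
    a \<in> principal_two_sided_ideal G b \<and> b \<in> principal_two_sided_ideal G a"
  using assms principal_two_sided_ideal_mono[of a b] principal_two_sided_ideal_mono[of b a]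
    mem_principal_two_sided_ideal_self[of a] mem_principal_two_sided_ideal_self[of b]
  unfolding green_J_def by auto

end

section \<open>Divisibility in terms of images\<close>

lemma orientation_preserving_section:
  assumes "orientation_preserving X f"
  shows "orientation_preserving (f ` X) (inv_into X f)"
proof -
  let ?T = "inv_into X f ` f ` X"
  have "orientation_preserving (f ` ?T) (inv_into X f)"
  proof (rule orientation_preserving_left_inverse)
    show "orientation_preserving ?T f"
      using assms by (rule orientation_preserving_subset) (auto intro: inv_into_into)
  qed (auto simp: f_inv_into_f)
  moreover have "f ` ?T = f ` X"
    by (simp add: image_image f_inv_into_f)
  ultimately show ?thesis by simp
qed

lemma orientation_preserving_if_admits_completable_inverse:
  assumes "inj_on \<theta> A" and "admits_completable_inverse X A \<theta>" and "\<theta> ` A \<subseteq> X"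
  shows "orientation_preserving A \<theta>"
proof -
  obtain \<gamma> where \<gamma>: "\<gamma> \<in> OP X" "\<And>x. x \<in> A \<Longrightarrow> \<gamma> (\<theta> x) = x"
    using assms(1,2) by (auto simp: admits_completable_inverse_def completable_def)
  have "orientation_preserving (\<gamma> ` \<theta> ` A) \<theta>"
  proof (rule orientation_preserving_left_inverse)
    show "orientation_preserving (\<theta> ` A) \<gamma>"
      using \<gamma>(1) assms(3) by (auto simp: OP_def intro: orientation_preserving_subset)
  qed (auto simp: \<gamma>(2))
  moreover have "\<gamma> ` \<theta> ` A = A"
    using \<gamma>(2) by (auto simp: image_image)
  ultimately show ?thesis by simp
qed

lemma mem_ideal_OP_iff:
  assumes \<alpha>: "\<alpha> \<in> OP X" and \<beta>: "\<beta> \<in> OP X"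
  shows "\<alpha> \<in> principal_two_sided_ideal (OP_monoid X) \<beta> \<longleftrightarrow>
    (\<exists>\<theta>. \<theta> \<in> \<alpha> ` X \<rightarrow> \<beta> ` X \<and> inj_on \<theta> (\<alpha> ` X) \<and> admits_completable_inverse X (\<alpha> ` X) \<theta>)"
    (is "?L \<longleftrightarrow> ?R")
proof
  assume ?L
  then obtain \<gamma> \<delta> where \<gamma>: "\<gamma> \<in> OP X" and \<delta>: "\<delta> \<in> OP X"
    and eq: "\<alpha> = compose X \<delta> (compose X \<beta> \<gamma>)"
    by (auto simp: principal_two_sided_ideal_def OP_monoid_def)
  have \<alpha>_eq: "\<alpha> x = \<delta> (\<beta> (\<gamma> x))" if "x \<in> X" for x
    using that by (simp add: eq compose_def)
  have \<gamma>X: "\<gamma> x \<in> X" if "x \<in> X" for x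
    using \<gamma> that by (auto simp: OP_def)
  \<comment> \<open>Pull a point of the image back along \<open>\<alpha>\<close>, then push it forward along all factors but the last.\<close>
  define \<theta> where "\<theta> y = \<beta> (\<gamma> (inv_into X \<alpha> y))" for y
  have inv: "\<delta> (\<theta> y) = y" if "y \<in> \<alpha> ` X" for y
    using \<alpha>_eq[of "inv_into X \<alpha> y"] that
    by (simp add: \<theta>_def inv_into_into f_inv_into_f)
  have "\<theta> \<in> \<alpha> ` X \<rightarrow> \<beta> ` X"
    using \<gamma>X by (auto simp: \<theta>_def intro!: imageI \<gamma>X inv_into_into)
  moreover have inj: "inj_on \<theta> (\<alpha> ` X)"
    using inv by (rule inj_on_inverseI)
  moreover have "admits_completable_inverse X (\<alpha> ` X) \<theta>"
    unfolding admits_completable_inverse_def completable_def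
  proof (intro bexI[OF _ \<delta>] ballI)
    fix z assume "z \<in> \<theta> ` \<alpha> ` X"
    then obtain y where "y \<in> \<alpha> ` X" "z = \<theta> y" by blast
    then show "\<delta> z = inv_into (\<alpha> ` X) \<theta> z"
      using inv inj by (simp add: inv_into_f_f)
  qed
  ultimately show ?R by blast
next
  assume ?R
  then obtain \<theta> where \<theta>: "\<theta> \<in> \<alpha> ` X \<rightarrow> \<beta> ` X" and inj: "inj_on \<theta> (\<alpha> ` X)"
    and aci: "admits_completable_inverse X (\<alpha> ` X) \<theta>" by blast
  obtain \<gamma> where \<gamma>: "\<gamma> \<in> OP X" "\<And>y. y \<in> \<alpha> ` X \<Longrightarrow> \<gamma> (\<theta> y) = y"
    using aci inj by (auto simp: admits_completable_inverse_def completable_def)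
  have \<beta>X: "\<beta> ` X \<subseteq> X" using \<beta> by (auto simp: OP_def)
  have \<theta>img: "\<theta> ` \<alpha> ` X \<subseteq> \<beta> ` X" using \<theta> by blast
  define \<sigma> where "\<sigma> = inv_into X \<beta>"
  define \<xi> where "\<xi> = (\<lambda>x\<in>X. \<sigma> (\<theta> (\<alpha> x)))"
  have "orientation_preserving (\<alpha> ` X) \<theta>"
    using inj aci by (rule orientation_preserving_if_admits_completable_inverse)
      (use \<theta>img \<beta>X in blast)
  moreover have "orientation_preserving (\<beta> ` X) \<sigma>"
    using \<beta> by (auto simp: OP_def \<sigma>_def intro: orientation_preserving_section)
  ultimately have "orientation_preserving (\<alpha> ` X) (\<sigma> \<circ> \<theta>)"
    using \<theta>img by (rule orientation_preserving_comp)
  then have "orientation_preserving X ((\<sigma> \<circ> \<theta>) \<circ> \<alpha>)"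
    using \<alpha> by (intro orientation_preserving_comp[of X \<alpha> "\<alpha> ` X"]) (auto simp: OP_def)
  then have "orientation_preserving X \<xi>"
    by (rule orientation_preserving_cong) (simp add: \<xi>_def)
  moreover have "\<xi> \<in> X \<rightarrow>\<^sub>E X"
    using \<theta> by (auto simp: \<xi>_def \<sigma>_def intro!: inv_into_into)
  ultimately have \<xi>: "\<xi> \<in> OP X" by (simp add: OP_def)
  have "compose X \<gamma> (compose X \<beta> \<xi>) = \<alpha>"
  proof (rule extensionalityI[of _ X])
    show "\<alpha> \<in> extensional X" using \<alpha> by (auto simp: OP_def PiE_def)
    fix x assume x: "x \<in> X"
    then have "\<theta> (\<alpha> x) \<in> \<beta> ` X" using \<theta> by blast
    then show "compose X \<gamma> (compose X \<beta> \<xi>) x = \<alpha> x"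
      using x \<gamma>(2) by (simp add: compose_def \<xi>_def \<sigma>_def f_inv_into_f)
  qed (rule compose_extensional)
  then show ?L
    using \<xi> \<gamma>(1) by (force simp: principal_two_sided_ideal_def OP_monoid_def)
qed

theorem theorem4p8:
  fixes X :: "'a::linorder set" and \<alpha> \<beta> :: "'a \<Rightarrow> 'a"
  assumes "\<alpha> \<in> OP X" and "\<beta> \<in> OP X"
  shows "(\<alpha>, \<beta>) \<in> green_J (OP_monoid X) \<longleftrightarrow>
    (\<exists>\<theta> \<tau>.
       \<theta> \<in> \<alpha> ` X \<rightarrow> \<beta> ` X \<and> inj_on \<theta> (\<alpha> ` X) \<and>
       admits_completable_inverse X (\<alpha> ` X) \<theta> \<and>
       \<tau> \<in> \<beta> ` X \<rightarrow> \<alpha> ` X \<and> inj_on \<tau> (\<beta> ` X) \<and>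
       admits_completable_inverse X (\<beta> ` X) \<tau>)"
proof -
  have "(\<alpha>, \<beta>) \<in> green_J (OP_monoid X) \<longleftrightarrow>
      \<alpha> \<in> principal_two_sided_ideal (OP_monoid X) \<beta> \<and>
      \<beta> \<in> principal_two_sided_ideal (OP_monoid X) \<alpha>"
    using assms by (intro monoid.green_J_iff_mem_ideals monoid_OP) (simp_all add: OP_monoid_def)
  with mem_ideal_OP_iff[OF assms] mem_ideal_OP_iff[OF assms(2,1)] show ?thesis
    by blast
qed

end
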